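(* Let $(k(n))_{n\ge 1}$ be a sequence of positive integers with $k(n)\to+\infty$, and let $X=\{\{X_{k,n},\ 1\le k\le k(n)\},\ n\ge 1\}$ be an array of random variables defined on the same probability space $(\Omega,\mathcal{A},\mathbb{P})$ such that, for each $n\ge 1$, the variables $X_{1,n},\dots,X_{k(n),n}$ are independent. Suppose that: (1) for all $n\ge 1$ and all $1\le k\le k(n)$, $X_{k,n}\sim\mathcal{G}^{\ast}(p_{k,n})$ (corrected geometric law) with $0<p_{k,n}=1-q_{k,n}<1$; (2) $\sup_{1\le k\le k(n)} q_{k,n}\to 0$ as $n\to+\infty$; (3) $\sum_{1\le k\le k(n)} q_{k,n}\to\lambda$ as $n\to+\infty$, for some $\lambda\in\,]0,+\infty[$. Then $S_n[X]=\sum_{k=1}^{k(n)}X_{k,n}$ converges in distribution, as $n\to+\infty$, to the Poisson law $\mathcal{P}(\lambda)$.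
   Context: The corrected geometric law $\mathcal{G}^{\ast}(p)=\mathcal{G}(p)-1$, $0<p<1$, is the law of $Y-1$ where $Y$ is geometric with parameter $p$ on $\{1,2,\dots\}$; that is, $X\sim\mathcal{G}^{\ast}(p)$ means $\mathbb{P}(X=j)=p(1-p)^j$ for $j=0,1,2,\dots$. $\mathcal{P}(\lambda)$ denotes the Poisson law with parameter $\lambda$. Within a row the variables need not be identically distributed, and nothing is assumed about dependence between different rows. *)

theory Defs
  imports "HOL-Probability.Probability"
begin

text \<open>The library's \<^const>\<open>geometric_pmf\<close> counts the failures before the first success, hence
  starts at 0; it is therefore the corrected geometric law, and the geometric law on
  \<open>{1, 2, \<dots>}\<close> is its image under \<^const>\<open>Suc\<close>.\<close>

definition corrected_geometric_law :: "real \<Rightarrow> real measure" where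
  "corrected_geometric_law p = distr (measure_pmf (geometric_pmf p)) borel real"

definition poisson_law :: "real \<Rightarrow> real measure" where
  "poisson_law rate = distr (measure_pmf (poisson_pmf rate)) borel real"

lemma measure_corrected_geometric_law:
  assumes "0 < p" "p \<le> 1"
  shows "measure (corrected_geometric_law p) {real j} = p * (1 - p) ^ j"
proof -
  have "real -` {real j} = {j}" by auto
  then show ?thesis
    using assms by (simp add: corrected_geometric_law_def measure_distr measure_pmf_single)
qed

lemma measure_poisson_law:
  assumes "0 < rate"
  shows "measure (poisson_law rate) {real j} = rate ^ j / fact j * exp (- rate)"
proof -
  have "real -` {real j} = {j}" by auto
  then show ?thesis
    using assms by (simp add: poisson_law_def measure_distr measure_pmf_single)
qed

end

theory Submission
  imports Defs
begin

text \<open>By Levy's continuity theorem it suffices to show convergence of characteristic functions.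
  With \<open>z = exp (\<i> t)\<close>, the characteristic function of the row sum is
  \<open>\<Prod>k. (1 - q k) / (1 - q k z)\<close>. Each factor differs from the Poisson factor \<open>exp (q k (z - 1))\<close>
  by \<open>O((q k)\<^sup>2)\<close>, and all factors have modulus at most 1, so the two products differ by
  \<open>O(\<Sum>k. (q k)\<^sup>2)\<close>, which is at most \<open>O((SUP k. q k) * (\<Sum>k. q k))\<close> and tends to 0.\<close>

text \<open>The mass function dominates the terms in modulus, so the integral defining
  \<open>char\<close> is an absolutely convergent series in powers of \<open>iexp t\<close>. By
  uniqueness of sums, both closed forms below follow by recognising a geometric and an exponential
  series.\<close>

lemma char_nat_pmf_sums:
  "(\<lambda>j. complex_of_real (pmf P j) * iexp t ^ j) sums char (distr (measure_pmf P) borel real) t"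
proof -
  let ?f = "\<lambda>j. pmf P j *\<^sub>R iexp (t * real j)"
  have "integrable (count_space UNIV) ?f"
    by (rule Bochner_Integration.integrable_bound[OF integrable_pmf[of UNIV P]]) auto
  then have "?f sums integral\<^sup>L (count_space UNIV) ?f"
    by (rule sums_integral_count_space_nat)
  moreover have "char (distr (measure_pmf P) borel real) t = integral\<^sup>L (count_space UNIV) ?f"
    unfolding char_def
    by (simp add: integral_distr measure_pmf_eq_density integral_density)
  moreover have "iexp (t * real j) = iexp t ^ j" for j
    by (simp add: exp_of_nat_mult[symmetric] mult_ac)
  ultimately show ?thesis
    by (simp add: scaleR_conv_of_real)
qed

lemma char_corrected_geometric_law:
  assumes "0 < p" "p \<le> 1"
  shows "char (corrected_geometric_law p) t =
    complex_of_real p / (1 - complex_of_real (1 - p) * iexp t)"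
proof -
  let ?c = "complex_of_real (1 - p) * iexp t"
  have "norm ?c < 1"
    using assms by (simp add: norm_mult del: of_real_diff)
  then have "(\<lambda>j. complex_of_real p * ?c ^ j) sums (complex_of_real p * (1 / (1 - ?c)))"
    by (intro sums_mult geometric_sums)
  moreover have "complex_of_real p * ?c ^ j = complex_of_real (pmf (geometric_pmf p) j) * iexp t ^ j" for j
    using assms by (simp add: power_mult_distrib)
  ultimately show ?thesis
    using sums_unique2[OF char_nat_pmf_sums[of "geometric_pmf p" t]]
    by (simp add: corrected_geometric_law_def)
qed

lemma char_poisson_law:
  assumes "0 < rate"
  shows "char (poisson_law rate) t = exp (complex_of_real rate * (iexp t - 1))"
proof -
  let ?c = "complex_of_real rate * iexp t"
  have "(\<lambda>j. complex_of_real (exp (- rate)) * (?c ^ j /\<^sub>R fact j))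
      sums (complex_of_real (exp (- rate)) * exp ?c)"
    by (intro sums_mult exp_converges)
  moreover have "complex_of_real (exp (- rate)) * (?c ^ j /\<^sub>R fact j) =
      complex_of_real (pmf (poisson_pmf rate) j) * iexp t ^ j" for j
    using assms by (simp add: power_mult_distrib scaleR_conv_of_real field_simps)
  moreover have "complex_of_real (exp (- rate)) * exp ?c = exp (complex_of_real rate * (iexp t - 1))"
    by (simp add: exp_of_real[symmetric] exp_add[symmetric] algebra_simps)
  ultimately show ?thesis
    using sums_unique2[OF char_nat_pmf_sums[of "poisson_pmf rate" t]]
    by (simp add: poisson_law_def)
qed

lemma real_distribution_poisson_law: "real_distribution (poisson_law rate)"
  unfolding poisson_law_def
  by (rule prob_space.real_distribution_distr) (auto intro: prob_space_measure_pmf)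

text \<open>Both functions share the first-order expansion \<open>1 + w\<close> with
  \<open>w = q (z - 1)\<close>. The geometric remainder contributes \<open>4 * q\<^sup>2\<close> and
  the exponential one \<open>12 * q\<^sup>2\<close>.\<close>

lemma geometric_poisson_factor_diff:
  fixes z :: complex
  assumes z: "cmod z = 1" and q: "0 \<le> q" "q \<le> 1 / 2"
  shows "cmod (of_real (1 - q) / (1 - of_real q * z) - exp (of_real q * (z - 1))) \<le> 16 * q\<^sup>2"
proof -
  define w where "w = of_real q * (z - 1)"
  define d where "d = 1 - of_real q * z"
  \<comment> \<open>Reverse triangle inequality: the modulus of \<open>d\<close> is at least
    \<open>1 - q\<close>, and q \<le> 1/2.\<close>
  have d: "1 / 2 \<le> cmod d"
    using norm_triangle_ineq2[of 1 "of_real q * z"] q z by (simp add: d_def norm_mult)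
  have "cmod (z - 1) \<le> 2"
    using norm_triangle_ineq4[of z 1] z by simp
  then have w: "cmod w \<le> 2 * q"
    using mult_left_mono[of "cmod (z - 1)" 2 q] q by (simp add: w_def norm_mult)
  have "cmod (of_real (1 - q) / d - (1 + w)) = cmod w * q / cmod d"
  proof -
    have "d \<noteq> 0" using d by auto
    \<comment> \<open>Since \<open>1 - q = d + w\<close>, the left side is
      \<open>w / d - w = w * (1 - d) / d\<close>, and \<open>1 - d = q z\<close>.\<close>
    then have "of_real (1 - q) / d - (1 + w) = w * (of_real q * z) / d"
      unfolding d_def w_def by (simp add: divide_simps) (simp add: algebra_simps)
    then show ?thesis using q z by (simp add: norm_mult norm_divide)
  qed
  also have "\<dots> \<le> (2 * q) * q / (1 / 2)"
    using w d q by (intro frac_le mult_mono) auto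
  finally have 1: "cmod (of_real (1 - q) / d - (1 + w)) \<le> 4 * q\<^sup>2"
    by (simp add: power2_eq_square)
  have "cmod (exp w - (1 + w)) \<le> exp (cmod w) * (cmod w)\<^sup>2"
    using Taylor_exp_field[of w 1] by (simp add: numeral_2_eq_2)
  also have "\<dots> \<le> 3 * (2 * q)\<^sup>2"
  proof (intro mult_mono power_mono)
    \<comment> \<open>Here \<open>cmod w\<close> is at most \<open>2 * q\<close>, hence at most 1,
      and e \<le> 3.\<close>
    have "exp (cmod w) \<le> exp 1" using w q by simp
    then show "exp (cmod w) \<le> 3" using exp_le by linarith
  qed (use w in auto)
  finally have 2: "cmod (exp w - (1 + w)) \<le> 12 * q\<^sup>2"
    by (simp add: power_mult_distrib)
  show ?thesis
    using norm_triangle_ineq4[of "of_real (1 - q) / d - (1 + w)" "exp w - (1 + w)"] 1 2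
    by (simp add: w_def d_def)
qed

text \<open>The modulus of an exponential is the exponential of the real part, which is nonpositive
  here. This supplies the unit bound on the Poisson factors for comparing products.\<close>

lemma norm_exp_scaled_minus_one_le_1:
  assumes "cmod z \<le> 1" "0 \<le> q"
  shows "cmod (exp (of_real q * (z - 1))) \<le> 1"
proof -
  have "q * (Re z - 1) \<le> 0"
    using assms complex_Re_le_cmod[of z] by (intro mult_nonneg_nonpos) auto
  then show ?thesis by simp
qed

theorem theorem2:
  fixes M :: "'a measure"
    and kn :: "nat \<Rightarrow> nat"
    and X :: "nat \<Rightarrow> nat \<Rightarrow> 'a \<Rightarrow> real"
    and p q :: "nat \<Rightarrow> nat \<Rightarrow> real"
    and rate :: real
  assumes "prob_space M"
    and "\<And>n. n \<ge> 1 \<Longrightarrow> kn n \<ge> 1"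
    and "filterlim kn at_top sequentially"
    and "\<And>n. n \<ge> 1 \<Longrightarrow> prob_space.indep_vars M (\<lambda>_. borel) (\<lambda>k. X k n) {1..kn n}"
    and "\<And>n k. n \<ge> 1 \<Longrightarrow> 1 \<le> k \<Longrightarrow> k \<le> kn n \<Longrightarrow>
           distr M borel (X k n) = corrected_geometric_law (p k n)"
    and "\<And>n k. n \<ge> 1 \<Longrightarrow> 1 \<le> k \<Longrightarrow> k \<le> kn n \<Longrightarrow>
           0 < p k n \<and> p k n = 1 - q k n \<and> p k n < 1"
    and "(\<lambda>n. SUP k\<in>{1..kn n}. q k n) \<longlonglongrightarrow> 0"
    and "(\<lambda>n. \<Sum>k=1..kn n. q k n) \<longlonglongrightarrow> rate"
    and "0 < rate"
  shows "weak_conv_m (\<lambda>n. distr M borel (\<lambda>\<omega>. \<Sum>k=1..kn n. X k n \<omega>)) (poisson_law rate)"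
proof -
  interpret prob_space M by fact
  let ?S = "\<lambda>n. distr M borel (\<lambda>\<omega>. \<Sum>k=1..kn n. X k n \<omega>)"
  let ?s = "\<lambda>n. SUP k\<in>{1..kn n}. q k n"
  have X_rv: "random_variable borel (X k n)" if "n \<ge> 1" "k \<in> {1..kn n}" for n k
    using assms(4)[OF that(1)] that(2) unfolding indep_vars_def2 by simp
  have q01: "0 < q k n" "q k n < 1" if "n \<ge> 1" "k \<in> {1..kn n}" for n k
    using assms(6)[of n k] that by auto
  have p_eq: "p k n = 1 - q k n" if "n \<ge> 1" "k \<in> {1..kn n}" for n k
    using assms(6)[of n k] that by auto
  have q_le: "q k n \<le> ?s n" if "k \<in> {1..kn n}" for n k
    using that by (intro cSUP_upper) auto

  have char_lim: "(\<lambda>n. char (?S n) t) \<longlonglongrightarrow> char (poisson_law rate) t" for t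
  proof -
    let ?z = "iexp t"
    \<comment> \<open>The intermediate target is Poisson with the row's own parameter, the sum of
      the \<open>q k n\<close>, so that it factors over \<open>k\<close>; the passage to
      \<open>rate\<close> comes afterwards by continuity.\<close>
    let ?P = "\<lambda>n. exp (complex_of_real (\<Sum>k=1..kn n. q k n) * (?z - 1))"
    have bound: "cmod (char (?S n) t - ?P n) \<le> 16 * (?s n * (\<Sum>k=1..kn n. q k n))"
      if n: "n \<ge> 1" and s: "?s n < 1 / 2" for n
    proof -
      have char_X: "char (distr M borel (X k n)) t =
          of_real (1 - q k n) / (1 - of_real (q k n) * ?z)" if "k \<in> {1..kn n}" for k
        using assms(5)[of n k] char_corrected_geometric_law[of "p k n" t] p_eq[OF n that]
          q01[OF n that] n that
        by simp
      have "char (?S n) t = (\<Prod>k=1..kn n. char (distr M borel (X k n)) t)"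
        by (rule char_distr_sum[OF assms(4)[OF n]])
      moreover have "?P n = (\<Prod>k=1..kn n. exp (of_real (q k n) * (?z - 1)))"
        by (simp add: exp_sum[symmetric] sum_distrib_right)
      \<comment> \<open>When all factors have modulus at most 1, telescoping bounds the difference
        of two products by the sum of the factorwise differences.\<close>
      ultimately have "cmod (char (?S n) t - ?P n) \<le>
          (\<Sum>k=1..kn n. cmod (char (distr M borel (X k n)) t - exp (of_real (q k n) * (?z - 1))))"
        using X_rv[OF n] q01[OF n]
        by (simp only:) (intro norm_prod_diff norm_exp_scaled_minus_one_le_1
            real_distribution.cmod_char_le_1 real_distribution_distr; simp add: less_imp_le)
      also have "\<dots> \<le> (\<Sum>k=1..kn n. 16 * (?s n * q k n))"
      proof (rule sum_mono)
        fix k assume k: "k \<in> {1..kn n}"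
        have "cmod (char (distr M borel (X k n)) t - exp (of_real (q k n) * (?z - 1))) \<le> 16 * (q k n)\<^sup>2"
          unfolding char_X[OF k]
          using q01[OF n k] q_le[OF k] s by (intro geometric_poisson_factor_diff) auto
        \<comment> \<open>Only one of the two factors \<open>q k n\<close> is replaced by the
          supremum; the other is kept so that the sum over the row stays bounded.\<close>
        also have "\<dots> \<le> 16 * (?s n * q k n)"
          using q01[OF n k] q_le[OF k] by (simp add: power2_eq_square)
        finally show "cmod (char (distr M borel (X k n)) t - exp (of_real (q k n) * (?z - 1)))
            \<le> 16 * (?s n * q k n)" .
      qed
      finally show ?thesis
        by (simp add: sum_distrib_left)
    qed
    have "\<forall>\<^sub>F n in sequentially. ?s n < 1 / 2"
      using assms(7) by (rule order_tendstoD) simp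
    then have ev: "\<forall>\<^sub>F n in sequentially.
        cmod (char (?S n) t - ?P n) \<le> 16 * (?s n * (\<Sum>k=1..kn n. q k n))"
      using eventually_ge_at_top[of 1] by eventually_elim (rule bound)
    have "(\<lambda>n. 16 * (?s n * (\<Sum>k=1..kn n. q k n))) \<longlonglongrightarrow> 16 * (0 * rate)"
      by (intro tendsto_intros assms(7,8))
    then have "(\<lambda>n. char (?S n) t - ?P n) \<longlonglongrightarrow> 0"
      by (intro Lim_null_comparison[OF ev]) simp
    moreover have "?P \<longlonglongrightarrow> char (poisson_law rate) t"
      unfolding char_poisson_law[OF assms(9)] by (intro tendsto_intros assms(8))
    ultimately show ?thesis
      by (rule Lim_transform[rotated])
  qed

  \<comment> \<open>Row 0 need not consist of random variables, so the continuity theorem is applied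
    to the shifted sequence.\<close>
  have "weak_conv_m (\<lambda>n. ?S (Suc n)) (poisson_law rate)"
  proof (rule levy_continuity)
    show "real_distribution (?S (Suc n))" for n
      by (intro real_distribution_distr borel_measurable_sum X_rv) auto
    show "(\<lambda>n. char (?S (Suc n)) t) \<longlonglongrightarrow> char (poisson_law rate) t" for t
      using char_lim by (rule LIMSEQ_Suc)
  qed (rule real_distribution_poisson_law)
  \<comment> \<open>Weak convergence is convergence of the distribution functions at each continuity
    point of the limit, and such a limit is unchanged by restoring row 0.\<close>
  then show ?thesis
    unfolding weak_conv_m_def weak_conv_def
    by (auto intro: LIMSEQ_imp_Suc)
qed

end
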